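(* Let $a,b,k$ be integers with $b\geq a\geq 2$ and $k\geq 0$, and let $G$ be a finite simple graph of order $n$ with $$n\geq\frac{(a+b-2)(2a+b-3)+2}{b}+\frac{bk}{b-1}.$$ Put $L=\left\lfloor\frac{(b(n-1)-bk)n-2(n-1)}{(a+b-1)(n-1)}\right\rfloor$. Assume that for every subset $X\subseteq V(G)$: if $|X|\geq L$ then $N_G(X)=V(G)$, and if $|X|<L$ then $$|N_G(X)|\geq\frac{(a+b-1)(n-1)}{b(n-1)-bk-2}|X|.$$ Then $G$ is fractional $(a,b,k)$-critical covered.
   Context: All graphs are finite, undirected and simple. For $X\subseteq V(G)$, $N_G(X)=\bigcup_{x\in X}N_G(x)$ is the set of vertices adjacent to at least one vertex of $X$, and $G-X$ is the subgraph induced by $V(G)\setminus X$. For integers $0\le a\le b$, a fractional $[a,b]$-factor of a graph $G$ is a function $h:E(G)\to[0,1]$ such that $a\leq \sum_{e\in E(v)}h(e)\leq b$ for every vertex $v$, where $E(v)$ is the set of edges incident with $v$. A graph $G$ is fractional $[a,b]$-covered if for every edge $e$ of $G$ there is a fractional $[a,b]$-factor $h$ of $G$ with $h(e)=1$. A graph $G$ is fractional $(a,b,k)$-critical covered if $G-Q$ is fractional $[a,b]$-covered for every $Q\subseteq V(G)$ with $|Q|=k$. *)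

theory Defs
  imports Complex_Main
begin

text \<open>A finite simple graph is given by its vertex set \<open>V\<close> and its set \<open>E\<close> of two-element edges.\<close>

definition simple_graph :: "'a set \<Rightarrow> 'a set set \<Rightarrow> bool" where
  "simple_graph V E \<longleftrightarrow> finite V \<and> (\<forall>e\<in>E. e \<subseteq> V \<and> card e = 2)"

definition nbrs :: "'a set set \<Rightarrow> 'a \<Rightarrow> 'a set" where
  "nbrs E x = {y. {x, y} \<in> E}"

definition nbrs_set :: "'a set set \<Rightarrow> 'a set \<Rightarrow> 'a set" where
  "nbrs_set E X = (\<Union>x\<in>X. nbrs E x)"

definition induced_edges :: "'a set set \<Rightarrow> 'a set \<Rightarrow> 'a set set" where
  "induced_edges E W = {e \<in> E. e \<subseteq> W}"

definition incident_edges :: "'a set set \<Rightarrow> 'a \<Rightarrow> 'a set set" where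
  "incident_edges E v = {e \<in> E. v \<in> e}"

text \<open>The values of \<open>h\<close> outside \<open>E\<close> are irrelevant.\<close>

definition fractional_factor ::
    "nat \<Rightarrow> nat \<Rightarrow> 'a set \<Rightarrow> 'a set set \<Rightarrow> ('a set \<Rightarrow> real) \<Rightarrow> bool" where
  "fractional_factor a b V E h \<longleftrightarrow>
     (\<forall>e\<in>E. 0 \<le> h e \<and> h e \<le> 1) \<and>
     (\<forall>v\<in>V. real a \<le> (\<Sum>e\<in>incident_edges E v. h e) \<and>
            (\<Sum>e\<in>incident_edges E v. h e) \<le> real b)"

definition fractional_covered :: "nat \<Rightarrow> nat \<Rightarrow> 'a set \<Rightarrow> 'a set set \<Rightarrow> bool" where
  "fractional_covered a b V E \<longleftrightarrow>
     (\<forall>e\<in>E. \<exists>h. fractional_factor a b V E h \<and> h e = 1)"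

definition fractional_critical_covered ::
    "nat \<Rightarrow> nat \<Rightarrow> nat \<Rightarrow> 'a set \<Rightarrow> 'a set set \<Rightarrow> bool" where
  "fractional_critical_covered a b k V E \<longleftrightarrow>
     (\<forall>Q. Q \<subseteq> V \<and> card Q = k \<longrightarrow>
          fractional_covered a b (V - Q) (induced_edges E (V - Q)))"

end

theory Submission
  imports Defs "HOL-Analysis.Function_Topology"
begin

text \<open>A fractional \<open>[a,b]\<close>-factor with value \<open>1\<close> at a given edge can fail to exist only if some disjoint \<open>S\<close>, \<open>T\<close> satisfy
  \<open>b|S| + (\<Sum>x\<in>T. d\<^bsub>G-S\<^esub>(x) - a) < 2\<close> (\<open>< 0\<close> if \<open>S\<close> is empty). Suppose this happens in \<open>G - Q\<close>,
  and put \<open>U = V - Q - S\<close>, \<open>s = |S|\<close>, so that \<open>|T| \<le> |U| = n - k - s\<close>. If \<open>T\<close> contains isolated vertices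
  of \<open>G[U]\<close>, they are missed by \<open>N(U)\<close>, and the expansion bound for \<open>U\<close> makes \<open>s\<close> too large.
  Otherwise let \<open>h \<ge> 1\<close> be the least degree in \<open>G[U]\<close> over \<open>T\<close>, so that \<open>s \<ge> \<delta>(G) - k - h\<close>. Now
  \<open>V - N(x)\<close> has at most \<open>L - 1\<close> elements, because \<open>x\<close> is not in its neighbourhood; the resulting lower
  bound for \<open>\<delta>(G)\<close> again makes \<open>s\<close> too large.\<close>

section \<open>Degree sums and the dual objective\<close>

text \<open>Double counting of incident pairs. It moves a weighting of the degrees onto the edges,
  where the best values can be chosen edge by edge.\<close>

lemma sum_incident_edges:
  fixes y :: "'a \<Rightarrow> real"
  assumes "simple_graph V E"
  shows "(\<Sum>v\<in>V. y v * (\<Sum>e\<in>incident_edges E v. h e)) = (\<Sum>e\<in>E. h e * (\<Sum>v\<in>e. y v))"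
proof -
  have fV: "finite V" and sub: "\<And>e. e \<in> E \<Longrightarrow> e \<subseteq> V"
    using assms by (auto simp: simple_graph_def)
  have fE: "finite E"
    by (rule finite_subset[of _ "Pow V"]) (use fV sub in auto)
  have "(\<Sum>v\<in>V. y v * (\<Sum>e\<in>incident_edges E v. h e)) = (\<Sum>v\<in>V. \<Sum>e | e \<in> E \<and> v \<in> e. y v * h e)"
    by (simp add: incident_edges_def sum_distrib_left)
  also have "\<dots> = (\<Sum>e\<in>E. \<Sum>v | v \<in> V \<and> v \<in> e. y v * h e)"
    by (rule sum.swap_restrict[OF fV fE])
  also have "\<dots> = (\<Sum>e\<in>E. h e * (\<Sum>v\<in>e. y v))"
  proof (rule sum.cong[OF refl])
    fix e assume "e \<in> E"
    then have "{v. v \<in> V \<and> v \<in> e} = e" using sub by auto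
    then show "(\<Sum>v | v \<in> V \<and> v \<in> e. y v * h e) = h e * (\<Sum>v\<in>e. y v)"
      by (simp add: sum_distrib_left mult.commute)
  qed
  finally show ?thesis .
qed

text \<open>This is the dual objective: \<open>y\<close> weighs the degree constraints, and \<open>h e0 = 1\<close> turns the term
  \<open>max 0\<close> of the edge \<open>e0\<close> into the plain sum of \<open>y\<close> over its ends.\<close>

definition dual_gap :: "real \<Rightarrow> real \<Rightarrow> 'a set \<Rightarrow> 'a set set \<Rightarrow> 'a set \<Rightarrow> ('a \<Rightarrow> real) \<Rightarrow> real" where
  "dual_gap a b V E e0 y =
     (\<Sum>e\<in>E. max 0 (\<Sum>v\<in>e. y v)) + min 0 (\<Sum>v\<in>e0. y v)
     - (\<Sum>v\<in>V. a * max 0 (y v) + b * min 0 (y v))"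

text \<open>Subtracting the smallest nonzero \<open>|y v|\<close> along the signs of \<open>y\<close> splits \<open>dual_gap\<close> additively. This
  reduces its nonnegativity to sign vectors, which are pairs \<open>(S, T)\<close>.\<close>

lemma max_peel:
  fixes c d m :: real
  assumes "m > 0" "c = 0 \<or> m \<le> \<bar>c\<bar>" "d = 0 \<or> m \<le> \<bar>d\<bar>"
  shows "max 0 (c + d) = m * max 0 (sgn c + sgn d) + max 0 ((c - m * sgn c) + (d - m * sgn d))"
  using assms
  by (cases c "0::real" rule: linorder_cases; cases d "0::real" rule: linorder_cases) (auto simp: max_def)

lemma dual_gap_peel:
  assumes G: "simple_graph V E" and e0: "e0 \<in> E" and m: "m > 0"
    and y: "\<And>v. v \<in> V \<Longrightarrow> y v = 0 \<or> m \<le> \<bar>y v\<bar>"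
  shows "dual_gap a b V E e0 y
       = m * dual_gap a b V E e0 (\<lambda>v. sgn (y v)) + dual_gap a b V E e0 (\<lambda>v. y v - m * sgn (y v))"
proof -
  have maxE: "max 0 (\<Sum>v\<in>e. y v) = m * max 0 (\<Sum>v\<in>e. sgn (y v)) + max 0 (\<Sum>v\<in>e. y v - m * sgn (y v))"
    if "e \<in> E" for e
  proof -
    have "card e = 2" "e \<subseteq> V" using G that by (auto simp: simple_graph_def)
    then obtain u v where uv: "e = {u, v}" "u \<noteq> v" by (auto simp: card_2_iff)
    then have "u \<in> V" "v \<in> V" using \<open>e \<subseteq> V\<close> by auto
    then show ?thesis using uv max_peel[OF m y y, of u v] by simp
  qed
  \<comment> \<open>This makes the term at \<open>e0\<close> split as well: the plain sum is linear
    in \<open>y\<close>, and \<open>maxE\<close> covers its positive part.\<close>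
  have min_eq: "min 0 x = x - max 0 x" for x :: real by auto
  have lin: "(\<Sum>v\<in>e0. y v) = m * (\<Sum>v\<in>e0. sgn (y v)) + (\<Sum>v\<in>e0. y v - m * sgn (y v))"
    by (simp add: sum_distrib_left sum_subtractf)
  have minE: "min 0 (\<Sum>v\<in>e0. y v) = m * min 0 (\<Sum>v\<in>e0. sgn (y v)) + min 0 (\<Sum>v\<in>e0. y v - m * sgn (y v))"
    unfolding min_eq using maxE[OF e0] lin by (simp add: algebra_simps)
  have vert: "a * max 0 (y v) + b * min 0 (y v) = m * (a * max 0 (sgn (y v)) + b * min 0 (sgn (y v)))
      + (a * max 0 (y v - m * sgn (y v)) + b * min 0 (y v - m * sgn (y v)))" if "v \<in> V" for v
    using y[OF that] m
    by (cases "y v" "0::real" rule: linorder_cases)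
      (auto simp: max_absorb1 max_absorb2 min_absorb1 min_absorb2 algebra_simps)
  have 1: "(\<Sum>e\<in>E. max 0 (\<Sum>v\<in>e. y v)) = m * (\<Sum>e\<in>E. max 0 (\<Sum>v\<in>e. sgn (y v))) + (\<Sum>e\<in>E. max 0 (\<Sum>v\<in>e. y v - m * sgn (y v)))"
    unfolding sum_distrib_left sum.distrib[symmetric] by (rule sum.cong[OF refl maxE])
  have 2: "(\<Sum>v\<in>V. a * max 0 (y v) + b * min 0 (y v)) = m * (\<Sum>v\<in>V. a * max 0 (sgn (y v)) + b * min 0 (sgn (y v)))
      + (\<Sum>v\<in>V. a * max 0 (y v - m * sgn (y v)) + b * min 0 (y v - m * sgn (y v)))"
    unfolding sum_distrib_left sum.distrib[symmetric]
    by (rule sum.cong[OF refl]) (use vert in \<open>simp add: algebra_simps\<close>)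
  show ?thesis
    unfolding dual_gap_def 1 2 minE by (simp add: algebra_simps)
qed

section \<open>Nonnegativity of the dual objective under the cut condition\<close>

lemma card_edges_avoiding:
  assumes G: "simple_graph V E" and "x \<notin> S"
  shows "card {e \<in> E. x \<in> e \<and> e \<inter> S = {}} = card (nbrs E x - S)"
proof -
  have "bij_betw (\<lambda>y. {x, y}) (nbrs E x - S) {e \<in> E. x \<in> e \<and> e \<inter> S = {}}"
  proof (rule bij_betwI')
    fix e assume e: "e \<in> {e \<in> E. x \<in> e \<and> e \<inter> S = {}}"
    then have "card e = 2" using G by (auto simp: simple_graph_def)
    then obtain y where "e = {x, y}" using e by (auto simp: card_2_iff)
    then show "\<exists>y\<in>nbrs E x - S. e = {x, y}" using e by (auto simp: nbrs_def)
  qed (use assms(2) in \<open>auto simp: nbrs_def doubleton_eq_iff\<close>)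
  then show ?thesis by (simp add: bij_betw_same_card)
qed

text \<open>With \<open>S\<close> and \<open>T\<close> the negative and positive vertices, an edge
  avoiding \<open>S\<close> contributes its number of ends in \<open>T\<close>, every other edge at
  least \<open>0\<close>, and the vertex sum is \<open>a|T| - b|S|\<close>. What remains is the cut
  condition, where \<open>2\<close> pays for the term at \<open>e0\<close>.\<close>

lemma dual_gap_sgn_nonneg:
  fixes a b :: nat and y :: "'a \<Rightarrow> real"
  assumes G: "simple_graph V E" and e0: "e0 \<in> E"
    and cut: "\<And>S T. S \<subseteq> V \<Longrightarrow> T \<subseteq> V \<Longrightarrow> S \<inter> T = {} \<Longrightarrow>
       a * card T + (if S = {} then 0 else 2) \<le> b * card S + (\<Sum>x\<in>T. card (nbrs E x - S))"
  shows "0 \<le> dual_gap a b V E e0 (\<lambda>v. sgn (y v))"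
proof -
  define S where "S = {v \<in> V. y v < 0}"
  define T where "T = {v \<in> V. y v > 0}"
  have fV: "finite V" and sub: "\<And>e. e \<in> E \<Longrightarrow> e \<subseteq> V" and c2: "\<And>e. e \<in> E \<Longrightarrow> card e = 2"
    using G by (auto simp: simple_graph_def)
  have fE: "finite E"
    by (rule finite_subset[of _ "Pow V"]) (use fV sub in auto)
  have fT: "finite T" using fV by (simp add: T_def)
  have "real (a * card T + (if S = {} then 0 else 2)) \<le> real (b * card S + (\<Sum>x\<in>T. card (nbrs E x - S)))"
    by (rule of_nat_mono, rule cut) (auto simp: S_def T_def)
  then have ge: "real a * card T + (if S = {} then 0 else 2) \<le> real b * card S + real (\<Sum>x\<in>T. card (nbrs E x - S))"
    by (auto split: if_splits)
  have "(\<Sum>v\<in>V. real a * max 0 (sgn (y v)) + real b * min 0 (sgn (y v)))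
      = (\<Sum>v\<in>V. (if v \<in> T then real a else 0) - (if v \<in> S then real b else 0))"
    by (rule sum.cong[OF refl]) (auto simp: S_def T_def sgn_if)
  also have "\<dots> = real a * card T - real b * card S"
    using fV by (simp add: sum_subtractf sum.If_cases S_def T_def Int_def)
  finally have vert: "(\<Sum>v\<in>V. real a * max 0 (sgn (y v)) + real b * min 0 (sgn (y v)))
      = real a * card T - real b * card S" .
  have e0_ge: "- (if S = {} then 0 else 2) \<le> min 0 (\<Sum>v\<in>e0. sgn (y v))"
  proof (cases "S = {}")
    case True
    then have "0 \<le> (\<Sum>v\<in>e0. sgn (y v))"
      using sub[OF e0] by (intro sum_nonneg) (auto simp: S_def sgn_if)
    then show ?thesis using True by simp
  next
    case False
    have "(\<Sum>v\<in>e0. - 1) \<le> (\<Sum>v\<in>e0. sgn (y v))"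
      by (rule sum_mono) (simp add: sgn_if)
    then show ?thesis using False c2[OF e0] by simp
  qed
  have "(\<Sum>x\<in>T. card (nbrs E x - S)) = (\<Sum>x\<in>T. \<Sum>e | e \<in> E \<and> (x \<in> e \<and> e \<inter> S = {}). 1)"
    by (rule sum.cong[OF refl]) (auto simp: S_def T_def card_edges_avoiding[OF G, symmetric])
  also have "\<dots> = (\<Sum>e\<in>E. \<Sum>x | x \<in> T \<and> (x \<in> e \<and> e \<inter> S = {}). 1)"
    by (rule sum.swap_restrict[OF fT fE])
  finally have "real (\<Sum>x\<in>T. card (nbrs E x - S)) = (\<Sum>e\<in>E. real (card {x \<in> T. x \<in> e \<and> e \<inter> S = {}}))"
    by simp
  also have "\<dots> \<le> (\<Sum>e\<in>E. max 0 (\<Sum>v\<in>e. sgn (y v)))"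
  proof (rule sum_mono)
    fix e assume e: "e \<in> E"
    show "real (card {x \<in> T. x \<in> e \<and> e \<inter> S = {}}) \<le> max 0 (\<Sum>v\<in>e. sgn (y v))"
    proof (cases "e \<inter> S = {}")
      case True
      have fe: "finite e" using sub[OF e] fV by (rule finite_subset)
      have "(\<Sum>v\<in>e. sgn (y v)) = (\<Sum>v\<in>e. if v \<in> T then 1 else 0)"
        by (rule sum.cong[OF refl]) (use True sub[OF e] in \<open>auto simp: S_def T_def sgn_if\<close>)
      also have "\<dots> = real (card {x \<in> T. x \<in> e \<and> e \<inter> S = {}})"
        using fe True by (simp add: sum.If_cases Int_def conj_commute)
      finally show ?thesis by simp
    qed simp
  qed
  finally have "real (\<Sum>x\<in>T. card (nbrs E x - S)) \<le> (\<Sum>e\<in>E. max 0 (\<Sum>v\<in>e. sgn (y v)))" .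
  then show ?thesis unfolding dual_gap_def vert using ge e0_ge by linarith
qed

text \<open>Induction on the size of the support: peeling off the smallest nonzero
  \<open>|y v|\<close> annihilates at least the minimiser \<open>w\<close> and creates no new
  nonzero value.\<close>

lemma dual_gap_nonneg:
  fixes a b :: nat and y :: "'a \<Rightarrow> real"
  assumes G: "simple_graph V E" and e0: "e0 \<in> E"
    and cut: "\<And>S T. S \<subseteq> V \<Longrightarrow> T \<subseteq> V \<Longrightarrow> S \<inter> T = {} \<Longrightarrow>
       a * card T + (if S = {} then 0 else 2) \<le> b * card S + (\<Sum>x\<in>T. card (nbrs E x - S))"
  shows "0 \<le> dual_gap a b V E e0 y"
proof (induction "card {v \<in> V. y v \<noteq> 0}" arbitrary: y rule: less_induct)
  case less
  have fV: "finite V" and sub: "\<And>e. e \<in> E \<Longrightarrow> e \<subseteq> V"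
    using G by (auto simp: simple_graph_def)
  show ?case
  proof (cases "\<exists>v\<in>V. y v \<noteq> 0")
    case False
    then have "(\<Sum>v\<in>e. y v) = 0" if "e \<in> E" for e
      using sub[OF that] by (intro sum.neutral) auto
    then show ?thesis using False e0 by (simp add: dual_gap_def)
  next
    case True
    define Z where "Z = {v \<in> V. y v \<noteq> 0}"
    define m where "m = Min ((\<lambda>v. \<bar>y v\<bar>) ` Z)"
    have Z: "finite Z" "Z \<noteq> {}" using fV True by (auto simp: Z_def)
    then have "m \<in> (\<lambda>v. \<bar>y v\<bar>) ` Z" unfolding m_def by (intro Min_in) auto
    then obtain w where w: "w \<in> Z" "m = \<bar>y w\<bar>" by auto
    have m: "m > 0" using w by (auto simp: Z_def)
    have le: "y v = 0 \<or> m \<le> \<bar>y v\<bar>" if "v \<in> V" for v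
    proof (cases "v \<in> Z")
      case True
      then show ?thesis unfolding m_def using Z by (intro disjI2 Min_le) auto
    qed (use that in \<open>simp add: Z_def\<close>)
    have "{v \<in> V. y v - m * sgn (y v) \<noteq> 0} \<subset> Z"
    proof
      have "w \<notin> {v \<in> V. y v - m * sgn (y v) \<noteq> 0}" by (simp add: w(2) abs_mult_sgn)
      then show "{v \<in> V. y v - m * sgn (y v) \<noteq> 0} \<noteq> Z" using w(1) by metis
    qed (auto simp: Z_def)
    then have "card {v \<in> V. y v - m * sgn (y v) \<noteq> 0} < card {v \<in> V. y v \<noteq> 0}"
      using psubset_card_mono[OF Z(1)] by (simp add: Z_def)
    then have "0 \<le> dual_gap a b V E e0 (\<lambda>v. y v - m * sgn (y v))" by (rule less)
    moreover have "0 \<le> dual_gap a b V E e0 (\<lambda>v. sgn (y v))"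
      by (rule dual_gap_sgn_nonneg[OF G e0 cut])
    ultimately show ?thesis
      using dual_gap_peel[OF G e0 m le] m by simp
  qed
qed

section \<open>Existence of the factor by least squares\<close>

text \<open>Clipping projects onto \<open>[a,b]\<close>. Hence the targets can be kept fixed while
  the degrees vary, at the price of an upper bound for the cost.\<close>

lemma clip_nearest:
  fixes a b c z :: real
  assumes "a \<le> c" "c \<le> b"
  shows "\<bar>max a (min b z) - z\<bar> \<le> \<bar>c - z\<bar>"
  using assms by (auto simp: max_def min_def)

text \<open>The factor is a minimiser of the total squared distance of the degrees from \<open>[a,b]\<close>. Its vector
  of deviations \<open>y\<close> satisfies \<open>dual_gap y \<le> - |y|\<^sup>2\<close> by first-order optimality, so it vanishes.\<close>

lemma fractional_covered_if_cut_condition: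
  fixes a b :: nat
  assumes G: "simple_graph V E" and ab: "a \<le> b"
    and cut: "\<And>S T. S \<subseteq> V \<Longrightarrow> T \<subseteq> V \<Longrightarrow> S \<inter> T = {} \<Longrightarrow>
       a * card T + (if S = {} then 0 else 2) \<le> b * card S + (\<Sum>x\<in>T. card (nbrs E x - S))"
  shows "fractional_covered a b V E"
  unfolding fractional_covered_def
proof
  fix e0 assume e0: "e0 \<in> E"
  have fV: "finite V" and sub: "\<And>e. e \<in> E \<Longrightarrow> e \<subseteq> V"
    using G by (auto simp: simple_graph_def)
  have fE: "finite E"
    by (rule finite_subset[of _ "Pow V"]) (use fV sub in auto)
  \<comment> \<open>All coordinates, also those off \<open>E\<close>, are confined to
    \<open>[0,1]\<close>, so that \<open>K\<close> is a product of compact sets.\<close>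
  define K :: "('a set \<Rightarrow> real) set"
    where "K = PiE UNIV (\<lambda>e. if e = e0 then {1} else {0..1})"
  have inK: "h \<in> K \<longleftrightarrow> h e0 = 1 \<and> (\<forall>e. 0 \<le> h e \<and> h e \<le> 1)" for h
  proof
    assume h: "h \<in> K"
    then have "h e \<in> (if e = e0 then {1} else {0..1})" for e
      unfolding K_def by (rule PiE_mem) simp
    then show "h e0 = 1 \<and> (\<forall>e. 0 \<le> h e \<and> h e \<le> 1)"
      by (metis atLeastAtMost_iff order.refl singletonD zero_le_one)
  qed (auto simp: K_def PiE_def)
  have "compactin (product_topology (\<lambda>_. euclidean) UNIV) K"
    unfolding K_def compactin_PiE by auto
  then have "compact K" by (simp add: euclidean_product_topology)
  define deg where "deg h v = (\<Sum>e\<in>incident_edges E v. h e)" for h :: "'a set \<Rightarrow> real" and v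
  define clip where "clip z = max (real a) (min (real b) z)" for z
  define cost where "cost h = (\<Sum>v\<in>V. (clip (deg h v) - deg h v)\<^sup>2)" for h
  have "continuous_on K cost"
    unfolding cost_def clip_def deg_def
    by (intro continuous_intros continuous_on_subset[OF continuous_on_product_coordinates]) auto
  moreover have "(\<lambda>_. 1) \<in> K" by (simp add: inK)
  ultimately obtain h where h: "h \<in> K" and h_min: "\<And>g. g \<in> K \<Longrightarrow> cost h \<le> cost g"
    using continuous_attains_inf[OF \<open>compact K\<close>] by blast
  define y where "y v = clip (deg h v) - deg h v" for v
  \<comment> \<open>Over \<open>K\<close>, this \<open>g\<close> maximises the degree sum weighted
    by \<open>y\<close>: each free edge is decided by the sign of the sum of \<open>y\<close> over
    its ends.\<close>
  define g :: "'a set \<Rightarrow> real"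
    where "g e = (if e = e0 \<or> (\<Sum>v\<in>e. y v) > 0 then 1 else 0)" for e
  have g: "g \<in> K" by (simp add: inK g_def)
  define D where "D v = deg g v - deg h v" for v
  \<comment> \<open>Moving from \<open>h\<close> towards \<open>g\<close> stays in \<open>K\<close>
    and cannot lower the cost; the squares are expanded with the targets of \<open>h\<close>, and
    one factor \<open>t\<close> is cancelled.\<close>
  have step: "2 * (\<Sum>v\<in>V. y v * D v) \<le> t * (\<Sum>v\<in>V. (D v)\<^sup>2)" if t: "0 < t" "t \<le> 1" for t
  proof -
    define f where "f e = h e + t * (g e - h e)" for e
    have "f e0 = 1" using h g by (simp add: f_def inK)
    moreover have "0 \<le> f e \<and> f e \<le> 1" for e
    proof -
      have "f e = (1 - t) * h e + t * g e" by (simp add: f_def algebra_simps)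
      moreover have "(1 - t) * h e + t * g e \<le> (1 - t) * 1 + t * 1"
        by (intro add_mono mult_left_mono) (use h g t in \<open>auto simp: inK\<close>)
      ultimately show ?thesis using h g t by (auto simp: inK)
    qed
    ultimately have "f \<in> K" by (simp add: inK)
    have degf: "deg f v = deg h v + t * D v" for v
      by (simp add: deg_def f_def D_def sum.distrib sum_distrib_left sum_subtractf algebra_simps)
    have "(\<Sum>v\<in>V. (y v)\<^sup>2) \<le> cost f"
      using h_min[OF \<open>f \<in> K\<close>] by (simp add: cost_def y_def)
    also have "\<dots> \<le> (\<Sum>v\<in>V. (clip (deg h v) - deg f v)\<^sup>2)"
      unfolding cost_def
    proof (rule sum_mono)
      fix v
      have "\<bar>clip (deg f v) - deg f v\<bar> \<le> \<bar>clip (deg h v) - deg f v\<bar>"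
        unfolding clip_def by (rule clip_nearest) (use ab in auto)
      then show "(clip (deg f v) - deg f v)\<^sup>2 \<le> (clip (deg h v) - deg f v)\<^sup>2"
        by (rule abs_le_square_iff[THEN iffD1])
    qed
    also have "\<dots> = (\<Sum>v\<in>V. (y v)\<^sup>2 - 2 * t * (y v * D v) + t * t * (D v)\<^sup>2)"
      by (rule sum.cong[OF refl]) (simp add: degf y_def power2_eq_square algebra_simps)
    also have "\<dots> = (\<Sum>v\<in>V. (y v)\<^sup>2) - t * (2 * (\<Sum>v\<in>V. y v * D v)) + t * (t * (\<Sum>v\<in>V. (D v)\<^sup>2))"
      by (simp add: sum.distrib sum_subtractf sum_distrib_left mult.assoc mult.left_commute)
    finally have "t * (2 * (\<Sum>v\<in>V. y v * D v)) \<le> t * (t * (\<Sum>v\<in>V. (D v)\<^sup>2))" by simp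
    then show ?thesis using t by simp
  qed
  have "2 * (\<Sum>v\<in>V. y v * D v) \<le> 0"
  proof (rule tendsto_lowerbound)
    show "((\<lambda>t. t * (\<Sum>v\<in>V. (D v)\<^sup>2)) \<longlongrightarrow> 0) (at_right 0)"
      by (intro tendsto_eq_intros) auto
    show "\<forall>\<^sub>F t in at_right 0. 2 * (\<Sum>v\<in>V. y v * D v) \<le> t * (\<Sum>v\<in>V. (D v)\<^sup>2)"
      unfolding eventually_at_right_field by (intro exI[of _ 1]) (use step in auto)
  qed simp
  then have opt: "(\<Sum>v\<in>V. y v * deg g v) \<le> (\<Sum>v\<in>V. y v * deg h v)"
    by (simp add: D_def right_diff_distrib sum_subtractf)
  have "(\<Sum>v\<in>V. y v * deg g v) = (\<Sum>e\<in>E. g e * (\<Sum>v\<in>e. y v))"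
    unfolding deg_def by (rule sum_incident_edges[OF G])
  also have "\<dots> = (\<Sum>e\<in>E. max 0 (\<Sum>v\<in>e. y v) + (if e = e0 then min 0 (\<Sum>v\<in>e0. y v) else 0))"
    by (rule sum.cong[OF refl]) (auto simp: g_def)
  also have "\<dots> = (\<Sum>e\<in>E. max 0 (\<Sum>v\<in>e. y v)) + min 0 (\<Sum>v\<in>e0. y v)"
    using e0 fE by (simp add: sum.distrib)
  finally have degg: "(\<Sum>v\<in>V. y v * deg g v) = (\<Sum>e\<in>E. max 0 (\<Sum>v\<in>e. y v)) + min 0 (\<Sum>v\<in>e0. y v)" .
  \<comment> \<open>The clipped degree is \<open>a\<close> where \<open>y v > 0\<close> and
    \<open>b\<close> where \<open>y v < 0\<close>; the square comes from
    \<open>deg h v = clip (deg h v) - y v\<close>.\<close>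
  have "(\<Sum>v\<in>V. y v * deg h v) = (\<Sum>v\<in>V. (real a * max 0 (y v) + real b * min 0 (y v)) - (y v)\<^sup>2)"
  proof (rule sum.cong[OF refl])
    fix v
    have "y v * clip (deg h v) = real a * max 0 (y v) + real b * min 0 (y v)"
      using ab by (auto simp: y_def clip_def max_def min_def)
    then show "y v * deg h v = (real a * max 0 (y v) + real b * min 0 (y v)) - (y v)\<^sup>2"
      by (simp add: y_def power2_eq_square algebra_simps)
  qed
  then have "dual_gap a b V E e0 y \<le> - (\<Sum>v\<in>V. (y v)\<^sup>2)"
    using opt degg by (simp add: dual_gap_def sum_subtractf)
  moreover have "0 \<le> dual_gap a b V E e0 y"
    by (rule dual_gap_nonneg[OF G e0 cut])
  ultimately have "(\<Sum>v\<in>V. (y v)\<^sup>2) = 0"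
    by (smt (verit) sum_nonneg zero_le_power2)
  then have y0: "\<forall>v\<in>V. y v = 0" using fV by (simp add: sum_nonneg_eq_0_iff)
  have "real a \<le> deg h v \<and> deg h v \<le> real b" if "v \<in> V" for v
    using y0[rule_format, OF that] ab by (auto simp: y_def clip_def max_def min_def split: if_splits)
  then have "fractional_factor a b V E h"
    using h by (simp add: fractional_factor_def inK deg_def)
  then show "\<exists>h. fractional_factor a b V E h \<and> h e0 = 1" using h by (auto simp: inK)
qed

section \<open>Two numerical estimates\<close>

text \<open>With \<open>P\<close>, \<open>g\<close>, \<open>N\<close> as in the proof, the claim
  reads \<open>(A - h) * N + 1 < (P - g) * s\<close>, and \<open>d\<close> gives
  \<open>(A - 1) * N + 2 - P * g \<le> P * s\<close>. After multiplication by \<open>P\<close> the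
  margin is \<open>P + g * (B * N - P * P - 2 + P * g)\<close>, positive by the bound on the
  order.\<close>

lemma edge_bound_slack_pos:
  fixes A B k n s :: real and h :: nat
  assumes A: "2 \<le> A" "A \<le> B" and h: "1 \<le> h" "real h \<le> A - 1"
    and n: "(A + B - 2) * (2 * A + B - 3) + 2 + B * k \<le> B * n"
    and d: "(A - 1) * (n + 1) + B + B * k + 2 \<le> (A + B - 1) * (s + k + real h)"
  shows "(A - real h) * (n - k - s) + 1 < B * s"
proof -
  define P where "P = A + B - 1"
  define g where "g = real h - 1"
  define N where "N = n - k"
  have h_eq: "real h = g + 1" by (simp add: g_def)
  have P: "0 < P" "0 < P - g" using A h by (auto simp: P_def g_def)
  \<comment> \<open>Integrality of \<open>h\<close> matters: for \<open>0 < g < 1\<close> the term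
    \<open>P * g\<close> could not replace the \<open>P\<close> in \<open>nonneg\<close>.\<close>
  have g: "g = 0 \<or> 1 \<le> g" using h(1) unfolding g_def by (cases "h = 1") auto
  have "(A - 2) * (P - 1) \<le> B * N - P * P - 2 + P"
    using n by (simp add: P_def N_def algebra_simps)
  moreover have "0 \<le> (A - 2) * (P - 1)" using A by (simp add: P_def)
  ultimately have nonneg: "0 \<le> B * N - P * P - 2 + P" by linarith
  have "0 \<le> g * (B * N - P * P - 2 + P * g)"
  proof (cases "g = 0")
    case False
    then have "1 \<le> g" using g by simp
    then have "P \<le> P * g" using P by simp
    then show ?thesis using nonneg \<open>1 \<le> g\<close> by (intro mult_nonneg_nonneg) auto
  qed simp
  then have "P * ((A - real h) * N + 1) < (P - g) * ((A - 1) * N + 2 - P * g)"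
    using P by (simp add: h_eq P_def algebra_simps)
  also have "\<dots> \<le> (P - g) * (P * s)"
    using d P by (intro mult_left_mono) (simp_all add: h_eq P_def N_def algebra_simps)
  finally have "P * ((A - real h) * N + 1) < P * ((P - g) * s)" by (simp add: algebra_simps)
  then have "(A - real h) * N + 1 < (P - g) * s" using P by simp
  then show ?thesis by (simp add: h_eq P_def N_def algebra_simps)
qed

text \<open>As \<open>(A - 1) * (n - k - s) - B * s = (A + B - 1) * (n - k - s) - B * (n -
  k)\<close>, multiplying by \<open>n - 1\<close> produces the term bounded by \<open>X\<close>. The
  rest is linear in \<open>l\<close>, negative at \<open>l = 1\<close> and nonincreasing by
  \<open>n\<close>.\<close>

lemma isolated_bound_slack_pos:
  fixes A B k n s l :: real
  assumes A: "2 \<le> A" "A \<le> B" and l: "1 \<le> l" and n1: "1 < n"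
    and n: "B * k + 2 \<le> (B - 1) * (n - 1)"
    and X: "(A + B - 1) * (n - 1) * (n - k - s) \<le> (n - l) * (B * (n - 1) - B * k - 2)"
  shows "(A - 1) * (n - k - s) + l + 1 < B * s"
proof -
  have "(n - 1) * ((A - 1) * (n - k - s) + l + 1 - B * s)
     = (A + B - 1) * (n - 1) * (n - k - s) + (n - 1) * (l + 1 - B * (n - k))"
    by (simp add: algebra_simps)
  also have "\<dots> \<le> (n - l) * (B * (n - 1) - B * k - 2) + (n - 1) * (l + 1 - B * (n - k))"
    using X by simp
  also have "\<dots> = - ((l - 1) * ((B - 1) * (n - 1) - (B * k + 2))) - (n - 1) * B"
    by (simp add: algebra_simps)
  also have "\<dots> < 0"
  proof -
    have "0 \<le> (l - 1) * ((B - 1) * (n - 1) - (B * k + 2))" using l n by simp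
    moreover have "0 < (n - 1) * B" using n1 A by simp
    ultimately show ?thesis by linarith
  qed
  finally have "(A - 1) * (n - k - s) + l + 1 - B * s < 0"
    using n1 by (simp add: mult_less_0_iff)
  then show ?thesis by simp
qed

section \<open>Neighbourhoods and induced subgraphs\<close>

lemma finite_nbrs:
  assumes "simple_graph V E"
  shows "nbrs E x \<subseteq> V" "finite (nbrs E x)"
proof -
  show "nbrs E x \<subseteq> V" using assms by (auto simp: simple_graph_def nbrs_def)
  then show "finite (nbrs E x)" using assms by (auto simp: simple_graph_def intro: finite_subset)
qed

lemma simple_graph_induced:
  assumes "simple_graph V E" "W \<subseteq> V"
  shows "simple_graph W (induced_edges E W)"
  using assms by (auto simp: simple_graph_def induced_edges_def intro: finite_subset)

lemma nbrs_induced: "x \<in> W \<Longrightarrow> nbrs (induced_edges E W) x = nbrs E x \<inter> W"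
  by (auto simp: nbrs_def induced_edges_def)

section \<open>Excluding a violated cut in \<open>G - Q\<close>\<close>

theorem theorem2:
  fixes V :: "'a set" and E :: "'a set set" and a b k n :: nat and L :: int
  assumes "a \<ge> 2" and "b \<ge> a"
    and "simple_graph V E" and "card V = n"
    and "real n \<ge> ((real a + real b - 2) * (2 * real a + real b - 3) + 2) / real b
           + real b * real k / (real b - 1)"
    and "L = \<lfloor>((real b * (real n - 1) - real b * real k) * real n - 2 * (real n - 1))
              / ((real a + real b - 1) * (real n - 1))\<rfloor>"
    and "\<And>X. X \<subseteq> V \<Longrightarrow> int (card X) \<ge> L \<Longrightarrow> nbrs_set E X = V"
    and "\<And>X. X \<subseteq> V \<Longrightarrow> int (card X) < L \<Longrightarrow>
           real (card (nbrs_set E X)) \<ge>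
             (real a + real b - 1) * (real n - 1)
               / (real b * (real n - 1) - real b * real k - 2) * real (card X)"
  shows "fractional_critical_covered a b k V E"
proof -
  note G = assms(3)
  have fV: "finite V" using G by (simp add: simple_graph_def)
  define A B c where "A = real a" and "B = real b" and "c = (A + B - 2) * (2 * A + B - 3) + 2"
  have A: "2 \<le> A" "A \<le> B" using assms(1,2) by (auto simp: A_def B_def)
  have "B * (B + 1) \<le> (A + B - 2) * (2 * A + B - 3)"
    using A by (intro mult_mono) auto
  then have c: "B * (B + 1) + 2 \<le> c" by (simp add: c_def)
  have n: "c / B + B * k / (B - 1) \<le> n"
    using assms(5) by (simp add: A_def B_def c_def)
  \<comment> \<open>Two forms of the order bound follow: \<open>n1\<close> weakens
    \<open>B * k / (B - 1)\<close> to \<open>k\<close>, and \<open>n2\<close> comes from multiplying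
    by \<open>B - 1\<close>.\<close>
  have "k \<le> B * k / (B - 1)" using A by (simp add: field_simps)
  then have "c / B + k \<le> n" using n by linarith
  then have n1: "c + B * k \<le> B * n" using A by (simp add: field_simps)
  have n2: "B * k + 2 \<le> (B - 1) * (real n - 1)"
  proof -
    have "1 * (B * (B + 1)) \<le> (B - 1) * (B * (B + 1))" using A by (intro mult_right_mono) auto
    also have "\<dots> \<le> (B - 1) * c" using c A by (intro mult_left_mono) auto
    finally have "B * (B + 1) \<le> (B - 1) * c" by simp
    then have "B + 1 \<le> (B - 1) * (c / B)" using A by (simp add: field_simps)
    moreover have "(B - 1) * (c / B + B * k / (B - 1)) \<le> (B - 1) * n"
      using n A by (intro mult_left_mono) auto
    moreover have "(B - 1) * (c / B + B * k / (B - 1)) = (B - 1) * (c / B) + B * k"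
      using A by (simp add: distrib_left)
    ultimately show ?thesis by (simp add: algebra_simps)
  qed
  have n_gt_1: "1 < real n"
  proof -
    have "0 < B * k + 2" using A by (simp add: add_nonneg_pos)
    then have "0 < (B - 1) * (real n - 1)" using n2 by linarith
    then show ?thesis using A by (simp add: zero_less_mult_iff)
  qed
  define q where "q = B * (real n - 1) - B * k - 2"
  have q: "0 < q"
  proof -
    have "0 < B * B" using A by simp
    then show ?thesis using n1 c by (simp add: q_def algebra_simps)
  qed
  \<comment> \<open>One vertex missed by the neighbourhood of \<open>X\<close> puts \<open>X\<close>
    into the range of the expansion bound.\<close>
  have small: "int (card X) < L" if "X \<subseteq> V" "x \<in> V" "x \<notin> nbrs_set E X" for X x
    using assms(7)[OF that(1)] that(2,3) by (metis linorder_not_le)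
  have expand: "(A + B - 1) * (real n - 1) * card X \<le> (real n - card Y) * q"
    if X: "X \<subseteq> V" and Y: "Y \<subseteq> V" "Y \<noteq> {}" "nbrs_set E X \<inter> Y = {}" for X Y
  proof -
    obtain x where "x \<in> Y" using Y by auto
    then have "int (card X) < L" using small[OF X, of x] Y by auto
    then have "(A + B - 1) * (real n - 1) / q * card X \<le> card (nbrs_set E X)"
      using assms(8)[OF X] by (simp add: A_def B_def q_def)
    moreover have "real (card (nbrs_set E X)) \<le> real n - card Y"
    proof -
      have "nbrs_set E X \<subseteq> V - Y"
        using finite_nbrs(1)[OF G] Y by (auto simp: nbrs_set_def)
      then have "card (nbrs_set E X) \<le> card (V - Y)" using fV by (intro card_mono) auto
      moreover have "card (V - Y) = n - card Y" "card Y \<le> n"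
        using Y fV assms(4) by (auto simp: card_Diff_subset finite_subset card_mono)
      ultimately show ?thesis by simp
    qed
    ultimately have "(A + B - 1) * (real n - 1) / q * card X \<le> real n - card Y" by linarith
    then show ?thesis using q by (simp add: field_simps)
  qed
  have deg: "(A - 1) * (real n + 1) + B + B * k + 2 \<le> (A + B - 1) * card (nbrs E x)" if x: "x \<in> V" for x
  proof -
    define X where "X = V - nbrs E x"
    have "x \<notin> nbrs_set E X" by (auto simp: X_def nbrs_set_def nbrs_def insert_commute)
    \<comment> \<open>Strictness over the integers yields the \<open>+ 1\<close>, which accounts for
      a summand \<open>A - 1 + B\<close> in the degree bound.\<close>
    then have "int (card X) + 1 \<le> L" using small[of X x] x by (auto simp: X_def)
    then have "real (card X) + 1 \<le> of_int L" by linarith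
    also have "\<dots> \<le> ((B * (real n - 1) - B * k) * n - 2 * (real n - 1)) / ((A + B - 1) * (real n - 1))"
      unfolding assms(6) A_def B_def by (rule of_int_floor_le)
    finally have "(real (card X) + 1) * ((A + B - 1) * (real n - 1)) \<le> (B * (real n - 1) - B * k) * n - 2 * (real n - 1)"
      using A n_gt_1 by (simp add: pos_le_divide_eq)
    \<comment> \<open>The two sides differ by \<open>B * k\<close>; giving it away makes
      \<open>n - 1\<close> a factor that cancels.\<close>
    also have "\<dots> \<le> (B * n - B * k - 2) * (real n - 1)"
      using A by (simp add: algebra_simps)
    finally have "(real (card X) + 1) * (A + B - 1) \<le> B * n - B * k - 2"
      using n_gt_1 by (simp add: mult.assoc[symmetric])
    moreover have "real (card X) = real n - card (nbrs E x)"
      using finite_nbrs[OF G, of x] card_mono[OF fV, of "nbrs E x"] assms(4)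
      by (simp add: X_def card_Diff_subset of_nat_diff)
    ultimately show ?thesis by (simp add: algebra_simps)
  qed
  show ?thesis
    unfolding fractional_critical_covered_def
  proof (intro allI impI)
    fix Q assume Q: "Q \<subseteq> V \<and> card Q = k"
    show "fractional_covered a b (V - Q) (induced_edges E (V - Q))"
    proof (rule fractional_covered_if_cut_condition[OF simple_graph_induced[OF G Diff_subset] assms(2)])
      fix S T assume S: "S \<subseteq> V - Q" and T: "T \<subseteq> V - Q" and ST: "S \<inter> T = {}"
      define U where "U = V - Q - S"
      define d where "d x = card (nbrs E x \<inter> U)" for x
      have "T \<subseteq> U" using S T ST by (auto simp: U_def)
      have fin: "finite T" "finite S" "finite Q" "finite U"
        using S T Q fV by (auto simp: U_def intro: finite_subset)
      have d: "(\<Sum>x\<in>T. card (nbrs (induced_edges E (V - Q)) x - S)) = (\<Sum>x\<in>T. d x)"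
      proof (rule sum.cong[OF refl])
        fix x assume "x \<in> T"
        then have "nbrs (induced_edges E (V - Q)) x - S = nbrs E x \<inter> U"
          using T by (auto simp: nbrs_induced U_def)
        then show "card (nbrs (induced_edges E (V - Q)) x - S) = d x" by (simp add: d_def)
      qed
      have "card (Q \<union> S) = k + card S" "Q \<union> S \<subseteq> V"
        using S Q fin by (auto intro: card_Un_disjoint)
      moreover have "U = V - (Q \<union> S)" by (auto simp: U_def)
      ultimately have U: "real (card U) = real n - k - card S"
        using assms(4) card_mono[OF fV, of "Q \<union> S"] fin by (simp add: card_Diff_subset of_nat_diff)
      have T_le: "real (card T) \<le> real n - k - card S"
        using card_mono[OF fin(4) \<open>T \<subseteq> U\<close>] U by linarith
      show "a * card T + (if S = {} then 0 else 2)
          \<le> b * card S + (\<Sum>x\<in>T. card (nbrs (induced_edges E (V - Q)) x - S))"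
        unfolding d
      proof (rule ccontr)
        assume neg: "\<not> a * card T + (if S = {} then 0 else 2) \<le> b * card S + (\<Sum>x\<in>T. d x)"
        \<comment> \<open>By integrality a failure leaves at most \<open>a * card T + 1\<close>; for
          empty \<open>S\<close> it is stronger still.\<close>
        then have "b * card S + (\<Sum>x\<in>T. d x) \<le> a * card T + 1" by (auto split: if_splits)
        then have "real (b * card S + (\<Sum>x\<in>T. d x)) \<le> real (a * card T + 1)" by (rule of_nat_mono)
        then have deficit: "B * card S + real (\<Sum>x\<in>T. d x) \<le> A * card T + 1"
          by (simp add: A_def B_def)
        define Z where "Z = {x \<in> T. d x = 0}"
        show False
        proof (cases "Z = {}")
          case False
          have "nbrs_set E U \<inter> Z = {}"
            using fin(4) by (auto simp: Z_def d_def nbrs_set_def nbrs_def insert_commute)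
          then have "(A + B - 1) * (real n - 1) * card U \<le> (real n - card Z) * q"
            using False T by (intro expand) (auto simp: U_def Z_def)
          moreover have "1 \<le> real (card Z)"
            using False fin by (simp add: Z_def Suc_le_eq card_gt_0_iff)
          ultimately have "(A - 1) * (real n - k - card S) + card Z + 1 < B * card S"
            using A n_gt_1 n2 by (intro isolated_bound_slack_pos) (simp_all add: U q_def)
          moreover have "(A - 1) * card T \<le> (A - 1) * (real n - k - card S)"
            using T_le A by (intro mult_left_mono) auto
          \<comment> \<open>Vertices of \<open>T\<close> outside \<open>Z\<close> have degree at
            least \<open>1\<close>, so \<open>A|T|\<close> minus the degree sum is at most
            \<open>(A - 1)|T| + |Z|\<close>.\<close>
          moreover have "card T \<le> (\<Sum>x\<in>T. d x) + card Z"
          proof -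
            have "card T = card (T - Z) + card Z"
              using fin by (simp add: Z_def card_Diff_subset card_mono)
            moreover have "(\<Sum>x\<in>T - Z. 1) \<le> (\<Sum>x\<in>T - Z. d x)"
              by (rule sum_mono) (auto simp: Z_def)
            moreover have "(\<Sum>x\<in>T - Z. d x) \<le> (\<Sum>x\<in>T. d x)"
              using fin by (intro sum_mono2) auto
            ultimately show ?thesis by simp
          qed
          then have "real (card T) \<le> real (\<Sum>x\<in>T. d x) + card Z"
            by (simp only: of_nat_add[symmetric] of_nat_le_iff)
          ultimately show False using deficit by (simp add: left_diff_distrib)
        next
          case True
          show False
          \<comment> \<open>If all degrees are at least \<open>a\<close>, they pay for
            \<open>a|T|\<close>, and \<open>b \<ge> 2\<close> pays for a nonempty
            \<open>S\<close>.\<close>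
          proof (cases "\<exists>x\<in>T. d x < a")
            case False
            then have "(\<Sum>x\<in>T. a) \<le> (\<Sum>x\<in>T. d x)" by (intro sum_mono) auto
            moreover have "2 \<le> b * card S" if "S \<noteq> {}"
              using mult_le_mono[of 2 b 1 "card S"] assms(1,2) that fin
              by (simp add: Suc_le_eq card_gt_0_iff)
            ultimately show False using neg by (auto simp: mult.commute split: if_splits)
          next
            case False': True
            define h where "h = Min (d ` T)"
            have "T \<noteq> {}" using False' by auto
            then have "h \<in> d ` T" unfolding h_def using fin by (intro Min_in) auto
            then obtain x where x: "x \<in> T" "d x = h" by auto
            have h_le: "h \<le> d y" if "y \<in> T" for y using that fin by (simp add: h_def)
            have "1 \<le> h" using True x by (auto simp: Z_def Suc_le_eq)
            have "h < a" using False' h_le by force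
            then have "real h \<le> A - 1" by (simp add: A_def)
            \<comment> \<open>Besides its \<open>h\<close> neighbours in \<open>U\<close>,
              \<open>x\<close> has only neighbours in \<open>Q\<close> and \<open>S\<close>.\<close>
            have "card (nbrs E x) \<le> card ((nbrs E x \<inter> U) \<union> (Q \<union> S))"
              using fin finite_nbrs[OF G, of x] by (intro card_mono) (auto simp: U_def)
            also have "\<dots> \<le> d x + card (Q \<union> S)" unfolding d_def by (rule card_Un_le)
            also have "\<dots> \<le> h + (k + card S)" using card_Un_le[of Q S] Q x by simp
            finally have "real (card (nbrs E x)) \<le> card S + k + real h" by linarith
            then have "(A + B - 1) * card (nbrs E x) \<le> (A + B - 1) * (card S + k + real h)"
              using A by (intro mult_left_mono) auto
            then have "(A - 1) * (real n + 1) + B + B * k + 2 \<le> (A + B - 1) * (card S + k + real h)"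
              using deg[of x] x T by auto
            then have "(A - real h) * (real n - k - card S) + 1 < B * card S"
              using A \<open>1 \<le> h\<close> \<open>real h \<le> A - 1\<close> n1 by (intro edge_bound_slack_pos) (simp_all add: c_def)
            \<comment> \<open>Here \<open>A - h\<close> is positive, so \<open>|T|\<close> may be
              enlarged to \<open>|U|\<close>.\<close>
            moreover have "(A - real h) * card T \<le> (A - real h) * (real n - k - card S)"
              using T_le \<open>real h \<le> A - 1\<close> by (intro mult_left_mono) auto
            moreover have "real h * card T \<le> real (\<Sum>x\<in>T. d x)"
              using sum_mono[of T "\<lambda>_. real h" "\<lambda>x. real (d x)"] h_le by (simp add: mult.commute)
            ultimately show False using deficit by (simp add: left_diff_distrib)
          qed
        qed
      qed
    qed
  qed
qed

end
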